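(* Let $G$ be a group, let $R$ and $T$ be $G$-graded rings, let $f:R\rightarrow T$ be a graded ring epimorphism, and let $I$ be a graded right ideal of $R$ such that $\mathrm{Ker}(f)\subseteq I^{2}$. If $f(I)$ is a graded almost prime right ideal of $T$, then $I$ is a graded almost prime right ideal of $R$.
   Context: Rings are associative, not assumed commutative, and not assumed to have a unity. A ring $R$ is $G$-graded if $R=\bigoplus_{g\in G}R_g$ with $R_g$ additive subgroups and $R_gR_h\subseteq R_{gh}$ for all $g,h\in G$; $x_g$ denotes the component of $x\in R$ in $R_g$. A right ideal $P$ is graded if $P=\bigoplus_{g\in G}(P\cap R_g)$, i.e. $x\in P$ implies $x_g\in P$ for all $g\in G$. The product $XY$ of right ideals is the set of finite sums of products $xy$ with $x\in X$, $y\in Y$, and $P^2=PP$. A ring homomorphism $f:R\to T$ of $G$-graded rings is graded if $f(R_g)\subseteq T_g$ for all $g\in G$; "epimorphism" means surjective homomorphism. A proper graded right ideal $P$ of a graded ring $R$ is graded almost prime if, for all graded right ideals $X,Y$ of $R$, $XY\subseteq P$ and $XY\nsubseteq P^2$ imply $X\subseteq P$ or $Y\subseteq P$. *)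

theory Defs
  imports Main
begin

text \<open>
  Rings are types of class \<^class>\<open>ring\<close>, which requires neither commutativity nor a unity.
  The grading group is a type of class \<^class>\<open>group_add\<close>; despite the additive notation this
  class does not assume commutativity, so \<open>g + h\<close> stands for the product \<open>gh\<close>.
\<close>

definition additive_subgroup :: "'a::ab_group_add set \<Rightarrow> bool" where
  "additive_subgroup H \<longleftrightarrow>
     0 \<in> H \<and> (\<forall>x\<in>H. \<forall>y\<in>H. x + y \<in> H) \<and> (\<forall>x\<in>H. - x \<in> H)"

definition decomposes :: "('g \<Rightarrow> 'a::ab_group_add set) \<Rightarrow> 'a \<Rightarrow> ('g \<Rightarrow> 'a) \<Rightarrow> bool" where
  "decomposes A x c \<longleftrightarrow>
     (\<forall>g. c g \<in> A g) \<and> finite {g. c g \<noteq> 0} \<and> x = (\<Sum>g | c g \<noteq> 0. c g)"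

text \<open>
  The first and last conjuncts say that the ring is the internal direct sum of the additive
  subgroups \<open>A g\<close>.
\<close>

definition grading :: "('g::group_add \<Rightarrow> 'a::ring set) \<Rightarrow> bool" where
  "grading A \<longleftrightarrow>
     (\<forall>g. additive_subgroup (A g)) \<and>
     (\<forall>g h. \<forall>x\<in>A g. \<forall>y\<in>A h. x * y \<in> A (g + h)) \<and>
     (\<forall>x. \<exists>!c. decomposes A x c)"

text \<open>Meaningful only if \<open>A\<close> is a grading.\<close>

definition component :: "('g \<Rightarrow> 'a::ab_group_add set) \<Rightarrow> 'a \<Rightarrow> 'g \<Rightarrow> 'a" where
  "component A x = (THE c. decomposes A x c)"

definition right_ideal :: "'a::ring set \<Rightarrow> bool" where
  "right_ideal P \<longleftrightarrow> additive_subgroup P \<and> (\<forall>x\<in>P. \<forall>r. x * r \<in> P)"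

definition graded_right_ideal :: "('g \<Rightarrow> 'a::ring set) \<Rightarrow> 'a set \<Rightarrow> bool" where
  "graded_right_ideal A P \<longleftrightarrow> right_ideal P \<and> (\<forall>x\<in>P. \<forall>g. component A x g \<in> P)"

definition ideal_product :: "'a::ring set \<Rightarrow> 'a set \<Rightarrow> 'a set" where
  "ideal_product X Y =
     {(\<Sum>i<n. x i * y i) | (n::nat) x y. \<forall>i<n. x i \<in> X \<and> y i \<in> Y}"

definition graded_almost_prime :: "('g \<Rightarrow> 'a::ring set) \<Rightarrow> 'a set \<Rightarrow> bool" where
  "graded_almost_prime A P \<longleftrightarrow>
     graded_right_ideal A P \<and> P \<noteq> UNIV \<and>
     (\<forall>X Y. graded_right_ideal A X \<longrightarrow> graded_right_ideal A Y \<longrightarrow>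
        ideal_product X Y \<subseteq> P \<longrightarrow> \<not> ideal_product X Y \<subseteq> ideal_product P P \<longrightarrow>
        X \<subseteq> P \<or> Y \<subseteq> P)"

definition graded_ring_hom ::
  "('g \<Rightarrow> 'a::ring set) \<Rightarrow> ('g \<Rightarrow> 'b::ring set) \<Rightarrow> ('a \<Rightarrow> 'b) \<Rightarrow> bool" where
  "graded_ring_hom A B f \<longleftrightarrow>
     (\<forall>x y. f (x + y) = f x + f y) \<and> (\<forall>x y. f (x * y) = f x * f y) \<and>
     (\<forall>g. f ` A g \<subseteq> B g)"

definition ker :: "('a::ring \<Rightarrow> 'b::ring) \<Rightarrow> 'a set" where
  "ker f = {x. f x = 0}"

end

theory Submission imports Defs
begin

text \<open>
  Additive subgroups containing the kernel can be compared in the image: if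
  \<open>ker f \<subseteq> H\<close>, then \<open>f ` Z \<subseteq> f ` H\<close> already gives \<open>Z \<subseteq> H\<close>
  (\<open>subset_if_image_subset\<close>). The hypothesis \<open>ker f \<subseteq> I\<^sup>2 \<subseteq> I\<close> makes
  this available both for \<open>I\<close> and for \<open>I\<^sup>2\<close>.

  Now let \<open>X\<close>, \<open>Y\<close> be graded right ideals with \<open>XY \<subseteq> I\<close> and \<open>XY \<not>\<subseteq> I\<^sup>2\<close>. Images under
  \<open>f\<close> are again graded right ideals, because \<open>f\<close> is surjective and commutes with taking
  homogeneous components (\<open>component_image\<close>), and \<open>f(XY) = f(X) f(Y)\<close>
  (\<open>image_ideal_product\<close>). So \<open>f(X) f(Y) \<subseteq> f(I)\<close>, and \<open>f(X) f(Y) \<subseteq> f(I)\<^sup>2 = f(I\<^sup>2)\<close> would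
  pull back to \<open>XY \<subseteq> I\<^sup>2\<close>. Almost primeness of \<open>f(I)\<close> therefore puts \<open>f(X)\<close> or \<open>f(Y)\<close>
  inside \<open>f(I)\<close>, and this inclusion pulls back to \<open>R\<close>.
\<close>

lemma additive_sum:
  fixes f :: "'a::ab_group_add \<Rightarrow> 'b::ab_group_add"
  assumes add: "\<And>x y. f (x + y) = f x + f y"
  shows "f (\<Sum>i\<in>S. c i) = (\<Sum>i\<in>S. f (c i))"
proof -
  have "f 0 = 0"
    using add[of 0 0] by simp
  then show ?thesis
    by (induction S rule: infinite_finite_induct) (simp_all add: add)
qed

lemma additive_uminus:
  fixes f :: "'a::ab_group_add \<Rightarrow> 'b::ab_group_add"
  assumes add: "\<And>x y. f (x + y) = f x + f y"
  shows "f (- x) = - f x"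
proof -
  have "f 0 = 0"
    using add[of 0 0] by simp
  then show ?thesis
    using add[of x "- x"] by (simp add: eq_neg_iff_add_eq_0 add.commute)
qed

lemma subset_if_image_subset:
  fixes f :: "'a::ring \<Rightarrow> 'b::ring"
  assumes add: "\<And>x y. f (x + y) = f x + f y"
    and H: "additive_subgroup H" and ker: "ker f \<subseteq> H" and img: "f ` Z \<subseteq> f ` H"
  shows "Z \<subseteq> H"
proof
  fix z assume "z \<in> Z"
  then obtain h where h: "h \<in> H" "f z = f h"
    using img by blast
  have "f (z + - h) = 0"
    using h(2) by (simp only: add additive_uminus[of f, OF add]) simp
  then have "z + - h \<in> H"
    using ker by (auto simp: ker_def)
  then have "(z + - h) + h \<in> H"
    using H h(1) unfolding additive_subgroup_def by blast
  then show "z \<in> H"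
    by simp
qed

lemma ideal_product_additive_subgroup:
  assumes X: "additive_subgroup X"
  shows "additive_subgroup (ideal_product X Y)"
  unfolding additive_subgroup_def
proof (intro conjI ballI)
  show "0 \<in> ideal_product X Y"
    unfolding ideal_product_def by (auto intro: exI[of _ "0::nat"])
next
  fix s t assume "s \<in> ideal_product X Y" "t \<in> ideal_product X Y"
  then obtain n x y m x' y'
    where s: "s = (\<Sum>i<(n::nat). x i * y i)" "\<forall>i<n. x i \<in> X \<and> y i \<in> Y"
      and t: "t = (\<Sum>i<(m::nat). x' i * y' i)" "\<forall>i<m. x' i \<in> X \<and> y' i \<in> Y"
    unfolding ideal_product_def by blast
  define u where "u i = (if i < n then x i else x' (i - n))" for i
  define v where "v i = (if i < n then y i else y' (i - n))" for i
  have "(\<Sum>i<n + m. u i * v i) = (\<Sum>i<n. u i * v i) + (\<Sum>i<m. u (n + i) * v (n + i))"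
    by (induction m) (simp_all add: add.assoc)
  also have "\<dots> = s + t"
    by (simp add: s(1) t(1) u_def v_def)
  finally have "s + t = (\<Sum>i<n + m. u i * v i)" ..
  moreover have "\<forall>i<n + m. u i \<in> X \<and> v i \<in> Y"
    using s(2) t(2) by (auto simp: u_def v_def)
  ultimately show "s + t \<in> ideal_product X Y"
    unfolding ideal_product_def by blast
next
  fix s assume "s \<in> ideal_product X Y"
  then obtain n x y where s: "s = (\<Sum>i<(n::nat). x i * y i)" "\<forall>i<n. x i \<in> X \<and> y i \<in> Y"
    unfolding ideal_product_def by blast
  have "- s = (\<Sum>i<n. (- x i) * y i)"
    by (simp add: s(1) sum_negf)
  moreover have "\<forall>i<n. - x i \<in> X \<and> y i \<in> Y"
    using s(2) X by (auto simp: additive_subgroup_def)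
  ultimately show "- s \<in> ideal_product X Y"
    unfolding ideal_product_def mem_Collect_eq
    by (intro exI[of _ n] exI[of _ "\<lambda>i. - x i"] exI[of _ y]) simp
qed

lemma ideal_product_subset_left:
  assumes "right_ideal P"
  shows "ideal_product P Y \<subseteq> P"
proof
  fix s assume "s \<in> ideal_product P Y"
  then obtain n x y where s: "s = (\<Sum>i<(n::nat). x i * y i)" "\<forall>i<n. x i \<in> P"
    unfolding ideal_product_def by blast
  have "(\<Sum>i<k. x i * y i) \<in> P" if "k \<le> n" for k
    using that assms s(2)
    by (induction k) (simp_all add: right_ideal_def additive_subgroup_def)
  then show "s \<in> P"
    using s(1) by simp
qed

lemma image_ideal_product:
  fixes f :: "'a::ring \<Rightarrow> 'b::ring"
  assumes add: "\<And>x y. f (x + y) = f x + f y" and mult: "\<And>x y. f (x * y) = f x * f y"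
  shows "f ` ideal_product X Y = ideal_product (f ` X) (f ` Y)"
proof (intro equalityI subsetI)
  fix s assume "s \<in> f ` ideal_product X Y"
  then obtain n x y
    where s: "s = f (\<Sum>i<(n::nat). x i * y i)" "\<forall>i<n. x i \<in> X \<and> y i \<in> Y"
    unfolding ideal_product_def by blast
  have "s = (\<Sum>i<n. f (x i) * f (y i))"
    by (simp add: s(1) additive_sum[of f, OF add] mult)
  moreover have "\<forall>i<n. f (x i) \<in> f ` X \<and> f (y i) \<in> f ` Y"
    using s(2) by blast
  ultimately show "s \<in> ideal_product (f ` X) (f ` Y)"
    unfolding ideal_product_def mem_Collect_eq
    by (intro exI[of _ n] exI[of _ "\<lambda>i. f (x i)"] exI[of _ "\<lambda>i. f (y i)"]) simp
next
  fix s assume "s \<in> ideal_product (f ` X) (f ` Y)"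
  then obtain n u v
    where s: "s = (\<Sum>i<(n::nat). u i * v i)" "\<forall>i<n. u i \<in> f ` X \<and> v i \<in> f ` Y"
    unfolding ideal_product_def by blast
  have "\<forall>i. \<exists>a b. i < n \<longrightarrow> a \<in> X \<and> b \<in> Y \<and> u i = f a \<and> v i = f b"
    using s(2) by blast
  then obtain x y where xy: "\<forall>i<n. x i \<in> X \<and> y i \<in> Y \<and> u i = f (x i) \<and> v i = f (y i)"
    by metis
  have "s = f (\<Sum>i<n. x i * y i)"
    by (simp add: s(1) additive_sum[of f, OF add] mult xy)
  moreover have "(\<Sum>i<n. x i * y i) \<in> ideal_product X Y"
    unfolding ideal_product_def using xy by blast
  ultimately show "s \<in> f ` ideal_product X Y"
    by blast
qed

text \<open>
  Applying \<open>f\<close> to each term of the homogeneous decomposition of \<open>x\<close> gives a homogeneous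
  decomposition of \<open>f x\<close>, and such decompositions are unique. Terms killed by \<open>f\<close> drop out of
  the support, which does not change the sum.
\<close>
lemma component_image:
  fixes f :: "'a::ring \<Rightarrow> 'b::ring"
  assumes R: "grading R" and T: "grading T" and f: "graded_ring_hom R T f"
  shows "component T (f x) g = f (component R x g)"
proof -
  have add: "\<And>x y. f (x + y) = f x + f y" and deg: "\<And>g. f ` R g \<subseteq> T g"
    using f by (auto simp: graded_ring_hom_def)
  have f0: "f 0 = 0"
    using add[of 0 0] by simp
  define c where "c = component R x"
  have "\<exists>!c. decomposes R x c"
    using R by (simp add: grading_def)
  then have "decomposes R x c"
    unfolding c_def component_def by (rule theI')
  then have hom: "\<And>g. c g \<in> R g" and fin: "finite {g. c g \<noteq> 0}"
    and x: "x = (\<Sum>g | c g \<noteq> 0. c g)"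
    by (auto simp: decomposes_def)
  have supp: "{g. f (c g) \<noteq> 0} \<subseteq> {g. c g \<noteq> 0}"
    using f0 by auto
  have "f x = (\<Sum>g | c g \<noteq> 0. f (c g))"
    using arg_cong[OF x, of f] by (simp add: additive_sum[of f, OF add])
  also have "\<dots> = (\<Sum>g | f (c g) \<noteq> 0. f (c g))"
    by (rule sum.mono_neutral_right[OF fin supp]) auto
  finally have "decomposes T (f x) (\<lambda>g. f (c g))"
    using hom deg finite_subset[OF supp fin] by (auto simp: decomposes_def)
  moreover have "\<exists>!d. decomposes T (f x) d"
    using T by (simp add: grading_def)
  ultimately have "component T (f x) = (\<lambda>g. f (c g))"
    unfolding component_def by (blast intro: the1_equality)
  then show ?thesis
    by (simp add: c_def)
qed

lemma graded_right_ideal_image: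
  fixes f :: "'a::ring \<Rightarrow> 'b::ring"
  assumes R: "grading R" and T: "grading T" and f: "graded_ring_hom R T f"
    and "surj f" and P: "graded_right_ideal R P"
  shows "graded_right_ideal T (f ` P)"
proof -
  have add: "\<And>x y. f (x + y) = f x + f y" and mult: "\<And>x y. f (x * y) = f x * f y"
    using f by (auto simp: graded_ring_hom_def)
  have f0: "f 0 = 0"
    using add[of 0 0] by simp
  have P0: "0 \<in> P" and Padd: "\<And>x y. x \<in> P \<Longrightarrow> y \<in> P \<Longrightarrow> x + y \<in> P"
    and Pneg: "\<And>x. x \<in> P \<Longrightarrow> - x \<in> P" and Pmult: "\<And>x r. x \<in> P \<Longrightarrow> x * r \<in> P"
    and Pcomp: "\<And>x g. x \<in> P \<Longrightarrow> component R x g \<in> P"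
    using P by (auto simp: graded_right_ideal_def right_ideal_def additive_subgroup_def)
  have "additive_subgroup (f ` P)"
    unfolding additive_subgroup_def
  proof (intro conjI ballI)
    show "0 \<in> f ` P"
      using P0 f0 by (metis imageI)
    show "u + v \<in> f ` P" if "u \<in> f ` P" "v \<in> f ` P" for u v
      using that Padd by (auto simp flip: add)
    show "- u \<in> f ` P" if "u \<in> f ` P" for u
      using that Pneg by (auto simp flip: additive_uminus[of f, OF add])
  qed
  moreover have "u * r \<in> f ` P" if u: "u \<in> f ` P" for u r
  proof -
    obtain a where "r = f a"
      using \<open>surj f\<close> by (meson surjD)
    then show ?thesis
      using u Pmult by (auto simp flip: mult)
  qed
  ultimately show ?thesis
    using Pcomp by (auto simp: graded_right_ideal_def right_ideal_def component_image[OF R T f])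
qed

theorem theorem2p14:
  fixes R :: "'g::group_add \<Rightarrow> 'a::ring set"
    and T :: "'g \<Rightarrow> 'b::ring set"
    and f :: "'a \<Rightarrow> 'b"
    and I :: "'a set"
  assumes "grading R"
    and "grading T"
    and "graded_ring_hom R T f"
    and "surj f"
    and "graded_right_ideal R I"
    and "ker f \<subseteq> ideal_product I I"
    and "graded_almost_prime T (f ` I)"
  shows "graded_almost_prime R I"
proof -
  have add: "\<And>x y. f (x + y) = f x + f y" and mult: "\<And>x y. f (x * y) = f x * f y"
    using assms(3) by (auto simp: graded_ring_hom_def)
  note img_ideal = graded_right_ideal_image[OF assms(1-4)]
  note img_prod = image_ideal_product[of f, OF add mult]
  have rI: "right_ideal I" and subI: "additive_subgroup I"
    using assms(5) by (auto simp: graded_right_ideal_def right_ideal_def)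
  have "ker f \<subseteq> I"
    using assms(6) ideal_product_subset_left[OF rI] by blast
  then have pull_I: "Z \<subseteq> I" if "f ` Z \<subseteq> f ` I" for Z
    using subset_if_image_subset[of f, OF add subI] that by blast
  have pull_I2: "Z \<subseteq> ideal_product I I" if "f ` Z \<subseteq> f ` ideal_product I I" for Z
    using subset_if_image_subset[of f, OF add ideal_product_additive_subgroup[OF subI] assms(6)]
      that by blast
  have proper: "f ` I \<noteq> UNIV"
    and prime: "\<And>X Y. graded_right_ideal T X \<Longrightarrow> graded_right_ideal T Y \<Longrightarrow>
      ideal_product X Y \<subseteq> f ` I \<Longrightarrow> \<not> ideal_product X Y \<subseteq> ideal_product (f ` I) (f ` I) \<Longrightarrow>
      X \<subseteq> f ` I \<or> Y \<subseteq> f ` I"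
    using assms(7) by (auto simp: graded_almost_prime_def)
  have "I \<noteq> UNIV"
    using proper \<open>surj f\<close> by blast
  moreover have "X \<subseteq> I \<or> Y \<subseteq> I"
    if X: "graded_right_ideal R X" and Y: "graded_right_ideal R Y"
      and sub: "ideal_product X Y \<subseteq> I" and nsub: "\<not> ideal_product X Y \<subseteq> ideal_product I I"
    for X Y
  proof -
    have "ideal_product (f ` X) (f ` Y) \<subseteq> f ` I"
      using sub by (simp flip: img_prod add: image_mono)
    moreover have "\<not> ideal_product (f ` X) (f ` Y) \<subseteq> ideal_product (f ` I) (f ` I)"
      using nsub pull_I2 by (auto simp flip: img_prod)
    ultimately have "f ` X \<subseteq> f ` I \<or> f ` Y \<subseteq> f ` I"
      using prime[OF img_ideal[OF X] img_ideal[OF Y]] by blast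
    then show ?thesis
      using pull_I by blast
  qed
  ultimately show ?thesis
    using assms(5) by (simp add: graded_almost_prime_def)
qed

end
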